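(* Let $\Pi=(\mathcal{P},\mathcal{L})$ be a finite projective plane whose order $n$ is prime. If $\Pi$ is magic over some Abelian group $G$, then $(\mathbb{Z}/n\mathbb{Z})^3$ is (isomorphic to) a subgroup of $G$.
   Context: A projective plane $\Pi=(\mathcal{P},\mathcal{L})$ consists of points $\mathcal{P}$ and lines $\mathcal{L}$ (subsets of $\mathcal{P}$) such that any two distinct points lie on a unique common line, any two distinct lines meet in a unique point, and there exist four points no three collinear. A finite projective plane has an order $n$: every line has $n+1$ points, every point is on $n+1$ lines, and $|\mathcal{P}|=|\mathcal{L}|=n^2+n+1$. For an Abelian group $G$, a function $v:\mathcal{P}\to G$ is magic if it is injective and $\sum_{x\in L}v(x)$ is the same for all $L\in\mathcal{L}$. $\Pi$ is magic over $G$ if such a $v$ exists. *)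

theory Defs
  imports "HOL-Algebra.Algebra" "HOL-Computational_Algebra.Primes"
begin

locale projective_plane =
  fixes P :: "'a set" and L :: "'a set set"
  assumes line_subset: "l \<in> L \<Longrightarrow> l \<subseteq> P"
    and ex1_line: "\<lbrakk>x \<in> P; y \<in> P; x \<noteq> y\<rbrakk> \<Longrightarrow> \<exists>!l. l \<in> L \<and> x \<in> l \<and> y \<in> l"
    and ex1_point: "\<lbrakk>l \<in> L; m \<in> L; l \<noteq> m\<rbrakk> \<Longrightarrow> \<exists>!x. x \<in> l \<and> x \<in> m"
    and ex_quadrangle:
      "\<exists>Q \<subseteq> P. card Q = 4 \<and> (\<forall>T \<subseteq> Q. card T = 3 \<longrightarrow> \<not> (\<exists>l \<in> L. T \<subseteq> l))"

text \<open>The order is the number \<open>n\<close> such that all lines have \<open>n + 1\<close> points. The other counts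
  usually listed with it are consequences; see \<open>projective_plane.order_counts\<close>.\<close>

definition has_order :: "'a set set \<Rightarrow> nat \<Rightarrow> bool" where
  "has_order L n \<longleftrightarrow> (\<forall>l \<in> L. card l = n + 1)"

text \<open>Groups in HOL-Algebra are written multiplicatively, so \<open>finprod\<close> over a line is the sum
  of the values on that line.\<close>

definition magic_function ::
  "'a set \<Rightarrow> 'a set set \<Rightarrow> ('g, 'r) monoid_scheme \<Rightarrow> ('a \<Rightarrow> 'g) \<Rightarrow> bool" where
  "magic_function P L G v \<longleftrightarrow>
     v \<in> P \<rightarrow> carrier G \<and> inj_on v P \<and> (\<exists>c. \<forall>l \<in> L. finprod G v l = c)"

definition magic_over ::
  "'a set \<Rightarrow> 'a set set \<Rightarrow> ('g, 'r) monoid_scheme \<Rightarrow> bool" where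
  "magic_over P L G \<longleftrightarrow> (\<exists>v. magic_function P L G v)"

context projective_plane
begin

lemma line_unique:
  "\<lbrakk>l \<in> L; m \<in> L; x \<in> l; x \<in> m; y \<in> l; y \<in> m; x \<noteq> y\<rbrakk> \<Longrightarrow> l = m"
  using ex1_point by blast

lemma ex_line_avoiding:
  assumes "p \<in> P"
  obtains l where "l \<in> L" "p \<notin> l"
proof -
  obtain Q where Q: "Q \<subseteq> P" "card Q = 4"
    and nc: "\<forall>T \<subseteq> Q. card T = 3 \<longrightarrow> \<not> (\<exists>l \<in> L. T \<subseteq> l)"
    using ex_quadrangle by (elim exE conjE)
  have fQ: "finite Q" using Q(2) by (intro card_ge_0_finite) simp
  have "card (Q - {p}) \<ge> 3" using Q(2) fQ by (simp add: card_Diff_singleton_if)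
  then obtain T where T: "T \<subseteq> Q - {p}" "card T = 3"
    by (rule obtain_subset_with_card_n)
  obtain a b c where abc: "T = {a, b, c}" "a \<noteq> b" "b \<noteq> c" "a \<noteq> c"
    using T(2) unfolding card_3_iff by blast
  have inP: "a \<in> P" "b \<in> P" "c \<in> P" and ne: "p \<noteq> a"
    using abc T Q by auto
  obtain l where l: "l \<in> L" "a \<in> l" "b \<in> l" using ex1_line[OF inP(1,2) abc(2)] by blast
  obtain m where m: "m \<in> L" "a \<in> m" "c \<in> m" using ex1_line[OF inP(1,3) abc(4)] by blast
  have "l \<noteq> m" using nc[rule_format, of T] T l m abc(1) by auto
  then have "p \<notin> l \<or> p \<notin> m" using line_unique[OF l(1) m(1) _ _ l(2) m(2)] ne by blast
  then show thesis using that l(1) m(1) by blast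
qed

lemma order_counts:
  assumes fin: "finite P" and ord: "has_order L n"
  shows "\<And>l. l \<in> L \<Longrightarrow> card l = n + 1"
    and "\<And>p. p \<in> P \<Longrightarrow> card {l \<in> L. p \<in> l} = n + 1"
    and "card P = n^2 + n + 1"
    and "card L = n^2 + n + 1"
proof -
  have finL: "finite L" using fin line_subset by (meson PowI finite_Pow_iff finite_subset subsetI)
  have finl: "finite l" if "l \<in> L" for l using fin line_subset that finite_subset by blast
  show cl: "card l = n + 1" if "l \<in> L" for l using ord that by (simp add: has_order_def)
  show cp: "card {l \<in> L. p \<in> l} = n + 1" if p: "p \<in> P" for p
  proof -
    obtain l where l: "l \<in> L" "p \<notin> l" using ex_line_avoiding[OF p] .
    have "\<exists>f. \<forall>m \<in> {m \<in> L. p \<in> m}. f m \<in> m \<and> f m \<in> l"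
      using ex1_point l by (intro bchoice) blast
    then obtain f where f: "\<And>m. \<lbrakk>m \<in> L; p \<in> m\<rbrakk> \<Longrightarrow> f m \<in> m \<and> f m \<in> l" by blast
    have "bij_betw f {m \<in> L. p \<in> m} l"
    proof (rule bij_betw_imageI)
      show "inj_on f {m \<in> L. p \<in> m}"
      proof (rule inj_onI)
        fix m m' assume h: "m \<in> {m \<in> L. p \<in> m}" "m' \<in> {m \<in> L. p \<in> m}" "f m = f m'"
        then have "f m \<in> m" "f m \<in> m'" "f m \<noteq> p"
          using f[of m] f[of m'] l by auto
        then show "m = m'" using h line_unique[of m m' p "f m"] by auto
      qed
      show "f ` {m \<in> L. p \<in> m} = l"
      proof
        show "f ` {m \<in> L. p \<in> m} \<subseteq> l" using f by auto
        show "l \<subseteq> f ` {m \<in> L. p \<in> m}"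
        proof
          fix x assume x: "x \<in> l"
          then have "x \<in> P" "x \<noteq> p" using l line_subset by auto
          then obtain m where m: "m \<in> L" "p \<in> m" "x \<in> m" using ex1_line p by metis
          have "f m = x" using ex1_point[of m l] f[OF m(1,2)] m l x by blast
          then show "x \<in> f ` {m \<in> L. p \<in> m}" using m by auto
        qed
      qed
    qed
    then show ?thesis using bij_betw_same_card cl[OF l(1)] by metis
  qed
  obtain p where p: "p \<in> P"
    using ex_quadrangle by fastforce
  have "P - {p} = (\<Union>l \<in> {l \<in> L. p \<in> l}. l - {p})"
  proof
    show "P - {p} \<subseteq> (\<Union>l \<in> {l \<in> L. p \<in> l}. l - {p})"
    proof
      fix x assume x: "x \<in> P - {p}"
      then obtain l where "l \<in> L" "p \<in> l" "x \<in> l" using ex1_line[of p x] p by auto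
      then show "x \<in> (\<Union>l \<in> {l \<in> L. p \<in> l}. l - {p})" using x by auto
    qed
  qed (use line_subset in auto)
  moreover have "card (\<Union>l \<in> {l \<in> L. p \<in> l}. l - {p}) = (\<Sum>l \<in> {l \<in> L. p \<in> l}. card (l - {p}))"
  proof (rule card_UN_disjoint)
    show "\<forall>l \<in> {l \<in> L. p \<in> l}. \<forall>m \<in> {l \<in> L. p \<in> l}. l \<noteq> m \<longrightarrow> (l - {p}) \<inter> (m - {p}) = {}"
    proof (intro ballI impI equals0I)
      fix l m x
      assume h: "l \<in> {l \<in> L. p \<in> l}" "m \<in> {l \<in> L. p \<in> l}" "l \<noteq> m" "x \<in> (l - {p}) \<inter> (m - {p})"
      then show False using line_unique[of l m p x] by auto
    qed
  qed (use finL finl in simp_all)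
  moreover have "\<dots> = (\<Sum>l \<in> {l \<in> L. p \<in> l}. n)"
    by (rule sum.cong) (auto simp: cl)
  ultimately have "card (P - {p}) = (n + 1) * n" using cp[OF p] by simp
  then have "card P = Suc ((n + 1) * n)" using card.remove[OF fin p] by simp
  then show "card P = n^2 + n + 1" by (simp add: power2_eq_square)
  obtain k where k: "k \<in> L" using ex_line_avoiding[OF p] .
  have "L - {k} = (\<Union>x \<in> k. {l \<in> L. x \<in> l} - {k})"
  proof
    show "L - {k} \<subseteq> (\<Union>x \<in> k. {l \<in> L. x \<in> l} - {k})"
    proof
      fix l assume l: "l \<in> L - {k}"
      then obtain x where "x \<in> l" "x \<in> k" using ex1_point[of l k] k by auto
      then show "l \<in> (\<Union>x \<in> k. {l \<in> L. x \<in> l} - {k})" using l by auto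
    qed
  qed auto
  moreover have "card (\<Union>x \<in> k. {l \<in> L. x \<in> l} - {k}) = (\<Sum>x \<in> k. card ({l \<in> L. x \<in> l} - {k}))"
  proof (rule card_UN_disjoint)
    show "\<forall>x \<in> k. \<forall>y \<in> k. x \<noteq> y \<longrightarrow> ({l \<in> L. x \<in> l} - {k}) \<inter> ({l \<in> L. y \<in> l} - {k}) = {}"
    proof (intro ballI impI equals0I)
      fix x y l
      assume h: "x \<in> k" "y \<in> k" "x \<noteq> y" "l \<in> ({l \<in> L. x \<in> l} - {k}) \<inter> ({l \<in> L. y \<in> l} - {k})"
      then show False using line_unique[of l k x y] k by auto
    qed
  qed (use finL finl k in simp_all)
  moreover have "\<dots> = (\<Sum>x \<in> k. n)"
    using k cp line_subset[OF k] by (intro sum.cong) (auto simp: card_Diff_singleton_if)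
  ultimately have "card (L - {k}) = (n + 1) * n" using cl[OF k] by simp
  then have "card L = Suc ((n + 1) * n)" using card.remove[OF finL k] by simp
  then show "card L = n^2 + n + 1" by (simp add: power2_eq_square)
qed

end

end

theory Submission
  imports Defs
begin

text \<open>Multiplying the line condition over the \<open>n + 1\<close> lines through a point \<open>x\<close> counts \<open>x\<close>
  itself \<open>n + 1\<close> times and every other point once, so \<open>v(x)\<^sup>n\<close> does not depend on \<open>x\<close>.
  Hence the quotients \<open>v(x) / v(x\<^sub>0)\<close> are \<open>n\<^sup>2 + n + 1\<close> distinct elements of the
  \<open>n\<close>-torsion of \<open>G\<close>. As \<open>n\<close> is prime, this torsion is a vector space over the field
  with \<open>n\<close> elements, and having more than \<open>n\<^sup>2\<close> elements it has dimension at least 3.\<close>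

text \<open>Addition in \<open>integer_mod_group n\<close> reduces modulo \<open>n\<close>. For an
  element killed by \<open>n\<close> this reduction does not change powers, so \<open>k\<close> maps
  to \<open>c [^] k\<close> homomorphically.\<close>

lemma (in group) int_pow_mod_torsion:
  fixes k :: int and n :: nat
  assumes c: "c \<in> carrier G" and tors: "c [^] n = \<one>"
  shows "c [^] (k mod int n) = c [^] k"
proof -
  have "c [^] k = c [^] (int n * (k div int n) + k mod int n)" by simp
  also have "\<dots> = (c [^] int n) [^] (k div int n) \<otimes> c [^] (k mod int n)"
    using c by (simp only: int_pow_mult int_pow_pow)
  also have "\<dots> = c [^] (k mod int n)" using c tors by (simp add: int_pow_int)
  finally show ?thesis by simp
qed

text \<open>If the prime \<open>n\<close> did not divide \<open>k\<close>, Bezout coefficients with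
  \<open>u * n + w * k = 1\<close> would give \<open>c = (c [^] k) [^] w\<close>, an element of
  \<open>K\<close>. So the cyclic group generated by \<open>c\<close> meets \<open>K\<close>
  trivially.\<close>

lemma (in group) prime_dvd_exponent:
  fixes k :: int and n :: nat
  assumes K: "subgroup K G" and c: "c \<in> carrier G" "c [^] n = \<one>" "c \<notin> K"
    and n: "Factorial_Ring.prime n" and k: "c [^] k \<in> K"
  shows "int n dvd k"
proof (rule ccontr)
  assume "\<not> int n dvd k"
  moreover have "Factorial_Ring.prime (int n)" using n by simp
  ultimately have "coprime (int n) k" by (rule prime_imp_coprime[rotated])
  then obtain u w where uw: "u * int n + w * k = 1"
    by (metis bezout_int coprime_iff_gcd_eq_1)
  have "c = c [^] (int n * u + k * w)"
    using uw c(1) by (metis int_pow_1 mult.commute)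
  also have "\<dots> = (c [^] int n) [^] u \<otimes> (c [^] k) [^] w"
    using c(1) by (simp only: int_pow_mult int_pow_pow)
  also have "\<dots> = (c [^] k) [^] w" using c by (simp add: int_pow_int)
  also have "\<dots> \<in> K" using K k by (simp add: subgroup_int_pow_closed)
  finally show False using c(3) by contradiction
qed

text \<open>Induction on \<open>d\<close>, adding one independent generator from \<open>S\<close> at
  a time. The exponent is \<open>d - 1\<close> because the last generator only has to avoid the
  image of the previous \<open>d - 1\<close> factors.\<close>

lemma (in comm_group) elementary_abelian_embedding:
  fixes n d :: nat
  assumes n: "Factorial_Ring.prime n"
    and S: "S \<subseteq> {x \<in> carrier G. x [^] n = \<one>}" and big: "n ^ (d - 1) < card S"
  shows "\<exists>h \<in> hom (product_group {..<d} (\<lambda>_. integer_mod_group n)) G.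
    inj_on h (carrier (product_group {..<d} (\<lambda>_. integer_mod_group n)))"
  using big
proof (induction d)
  case 0
  have "(\<lambda>_. \<one>) \<in> hom (product_group {..<0::nat} (\<lambda>_. integer_mod_group n)) G"
    by (simp add: hom_def)
  then show ?case by (rule bexI[rotated]) simp
next
  case (Suc d)
  have n0: "n > 0" using n by (simp add: prime_gt_0_nat)
  let ?Z = "\<lambda>d::nat. product_group {..<d} (\<lambda>_. integer_mod_group n)"
  have grp: "group (?Z d)" for d by simp
  \<comment> \<open>For \<open>d = 0\<close> the truncated exponent \<open>d - 1\<close> is 0, so
    both sides are 1.\<close>
  have "n ^ (d - 1) \<le> n ^ d" using n0 by (intro power_increasing) auto
  then have "n ^ (d - 1) < card S" using Suc.prems by simp
  then obtain h where h: "h \<in> hom (?Z d) G" and inj: "inj_on h (carrier (?Z d))"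
    using Suc.IH by blast
  interpret h: group_hom "?Z d" G h
    using grp h by (simp add: group_hom_def group_hom_axioms_def)
  let ?K = "h ` carrier (?Z d)"
  have K: "subgroup ?K G" by (rule h.img_is_subgroup)
  \<comment> \<open>The image \<open>?K\<close> is too small to contain \<open>S\<close>; any
    element \<open>c\<close> of \<open>S\<close> outside it can serve as the new generator.\<close>
  have "card (carrier (?Z d)) = n ^ d"
    using n0 by (simp add: card_PiE carrier_integer_mod_group)
  then have "card ?K < card S" using Suc.prems inj by (simp only: card_image) simp
  moreover have "finite ?K"
    using n0 by (intro finite_imageI) (simp add: carrier_integer_mod_group finite_PiE)
  ultimately have "\<not> S \<subseteq> ?K" using card_mono by (meson not_le)
  then obtain c where "c \<in> S" and cK: "c \<notin> ?K" by blast
  then have c: "c \<in> carrier G" "c [^] n = \<one>" using S by auto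
  \<comment> \<open>Elements of a product group are extensional, so dropping the last coordinate
    means making it \<open>undefined\<close>. The extended map \<open>?g\<close> sends that
    coordinate to a power of \<open>c\<close>.\<close>
  let ?r = "\<lambda>f::nat \<Rightarrow> int. restrict f {..<d}"
  let ?g = "\<lambda>f::nat \<Rightarrow> int. h (?r f) \<otimes> c [^] f d"
  have r: "?r f \<in> carrier (?Z d)" if "f \<in> carrier (?Z (Suc d))" for f
    using that by (auto simp: PiE_iff)
  have hom: "?g \<in> hom (?Z (Suc d)) G"
  proof (rule homI)
    fix f assume "f \<in> carrier (?Z (Suc d))"
    then show "?g f \<in> carrier G" using r c h.hom_closed by blast
  next
    fix f f' assume f: "f \<in> carrier (?Z (Suc d))" "f' \<in> carrier (?Z (Suc d))"
    have "?r (f \<otimes>\<^bsub>?Z (Suc d)\<^esub> f') = ?r f \<otimes>\<^bsub>?Z d\<^esub> ?r f'" by (auto simp: fun_eq_iff)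
    then have "h (?r (f \<otimes>\<^bsub>?Z (Suc d)\<^esub> f')) = h (?r f) \<otimes> h (?r f')"
      using h.hom_mult[OF r[OF f(1)] r[OF f(2)]] by simp
    moreover have "c [^] ((f \<otimes>\<^bsub>?Z (Suc d)\<^esub> f') d) = c [^] f d \<otimes> c [^] f' d"
      using int_pow_mod_torsion[OF c, of "f d + f' d"] c by (simp add: int_pow_mult)
    moreover have "(h (?r f) \<otimes> h (?r f')) \<otimes> (c [^] f d \<otimes> c [^] f' d) = ?g f \<otimes> ?g f'"
    proof -
      have "(a \<otimes> a') \<otimes> (b \<otimes> b') = (a \<otimes> b) \<otimes> (a' \<otimes> b')"
        if "a \<in> carrier G" "a' \<in> carrier G" "b \<in> carrier G" "b' \<in> carrier G" for a a' b b'
        using that by (simp add: m_ac)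
      then show ?thesis
        by (simp only: h.hom_closed[OF r[OF f(1)]] h.hom_closed[OF r[OF f(2)]] int_pow_closed[OF c(1)])
    qed
    ultimately show "?g (f \<otimes>\<^bsub>?Z (Suc d)\<^esub> f') = ?g f \<otimes> ?g f'" by (simp only:)
  qed
  interpret g: group_hom "?Z (Suc d)" G ?g
    using grp hom by (simp add: group_hom_def group_hom_axioms_def)
  have "inj_on ?g (carrier (?Z (Suc d)))"
    unfolding g.inj_on_one_iff
  proof (intro allI impI)
    fix f assume f: "f \<in> carrier (?Z (Suc d))" and g1: "?g f = \<one>"
    have hr: "h (?r f) \<in> ?K" using r[OF f] by (rule imageI)
    \<comment> \<open>A kernel element puts this power of \<open>c\<close> into \<open>?K\<close>,
      so \<open>n\<close> divides \<open>f d\<close>; as \<open>f d\<close> is a representative in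
      \<open>{0..<int n}\<close>, it is 0. Then \<open>h\<close> kills the remaining coordinates,
      which vanish by injectivity.\<close>
    have "c [^] f d = inv (h (?r f))"
      using g1 c h.hom_closed[OF r[OF f]] by (metis int_pow_closed inv_equality m_comm)
    then have "c [^] f d \<in> ?K" using subgroup.m_inv_closed[OF K hr] by simp
    then have "int n dvd f d" using prime_dvd_exponent[OF K c cK n] by blast
    moreover have "f d \<in> {0..<int n}"
      using f n0 by (auto simp: PiE_iff carrier_integer_mod_group)
    ultimately have fd: "f d = 0"
      by (metis atLeastLessThan_iff dvd_imp_mod_0 mod_pos_pos_trivial)
    then have "h (?r f) = \<one>" using g1 h.hom_closed[OF r[OF f]] by simp
    then have "?r f = \<one>\<^bsub>?Z d\<^esub>"
      using inj r[OF f] unfolding h.inj_on_one_iff by blast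
    then have "f i = 0" if "i < d" for i using that
      by (metis lessThan_iff one_integer_mod_group one_product_group restrict_apply')
    then have "f i = 0" if "i < Suc d" for i using that fd less_Suc_eq by blast
    moreover have "f \<in> extensional {..<Suc d}" using f by (simp add: PiE_iff)
    ultimately show "f = \<one>\<^bsub>?Z (Suc d)\<^esub>"
      by (auto simp: fun_eq_iff extensional_def)
  qed
  with hom show ?case by blast
qed

text \<open>The right-hand side and the factor \<open>finprod G v P\<close> do not involve
  \<open>x\<close>, so cancelling that factor shows that \<open>v x [^] n\<close> is constant on
  \<open>P\<close>.\<close>

lemma magic_power_constant:
  fixes G :: "('g, 'r) monoid_scheme" (structure)
  assumes "projective_plane P L" and fin: "finite P" and ord: "has_order L n"
    and "comm_group G"
    and v: "v \<in> P \<rightarrow> carrier G" and sums: "\<And>l. l \<in> L \<Longrightarrow> finprod G v l = c"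
    and x: "x \<in> P"
  shows "v x [^] n \<otimes> finprod G v P = c [^] (n + 1)"
proof -
  interpret projective_plane P L by fact
  interpret comm_group G by fact
  let ?Lx = "{l \<in> L. x \<in> l}"
  have card: "card ?Lx = n + 1" using order_counts(2)[OF fin ord x] .
  then have finLx: "finite ?Lx" using card.infinite by force
  have finl: "finite l" if "l \<in> L" for l using fin line_subset that finite_subset by blast
  have vx: "v x \<in> carrier G" using v x by blast
  have vl: "v y \<in> carrier G" if "l \<in> L" "y \<in> l" for l y using v line_subset that by blast
  \<comment> \<open>Some line exists, and \<open>c\<close> is the product along it, hence in the
    carrier.\<close>
  obtain l0 where "l0 \<in> L" using ex_line_avoiding[OF x] .
  then have c: "c \<in> carrier G" using sums[of l0] vl finprod_closed[of v l0] by auto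
  \<comment> \<open>The lines through \<open>x\<close>, with \<open>x\<close> removed, partition the
    other points.\<close>
  have un: "P - {x} = (\<Union>l \<in> ?Lx. l - {x})"
  proof
    show "P - {x} \<subseteq> (\<Union>l \<in> ?Lx. l - {x})"
    proof
      fix y assume y: "y \<in> P - {x}"
      then obtain l where "l \<in> L" "x \<in> l" "y \<in> l" using ex1_line[of x y] x by auto
      then show "y \<in> (\<Union>l \<in> ?Lx. l - {x})" using y by auto
    qed
  qed (use line_subset in auto)
  have prodP: "finprod G v (P - {x}) = finprod G (\<lambda>l. finprod G v (l - {x})) ?Lx"
    unfolding un
  proof (rule finprod_UN_disjoint[OF finLx])
    show "pairwise (\<lambda>l m. disjnt (l - {x}) (m - {x})) ?Lx"
    proof (rule pairwiseI)
      fix l m assume "l \<in> ?Lx" "m \<in> ?Lx" "l \<noteq> m"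
      then show "disjnt (l - {x}) (m - {x})"
        using line_unique[of l m x] by (auto simp: disjnt_iff)
    qed
  qed (use finl vl in auto)
  have split: "finprod G v A = v x \<otimes> finprod G v (A - {x})"
    if "finite A" "x \<in> A" "A \<subseteq> P" for A
  proof -
    have "finprod G v (insert x (A - {x})) = v x \<otimes> finprod G v (A - {x})"
      using that v vx by (intro finprod_insert) auto
    then show ?thesis using that(2) by (simp add: insert_absorb)
  qed
  have rest: "finprod G v (l - {x}) \<in> carrier G" if "l \<in> L" for l
    using vl that by (intro finprod_closed) auto
  have "c [^] (n + 1) = finprod G (\<lambda>_. c) ?Lx" using c by (simp only: finprod_const card)
  also have "\<dots> = finprod G (\<lambda>l. v x \<otimes> finprod G v (l - {x})) ?Lx"
  proof (rule finprod_cong')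
    fix l assume "l \<in> ?Lx"
    then show "c = v x \<otimes> finprod G v (l - {x})"
      using split[of l] finl line_subset sums by auto
  qed (use vx rest in auto)
  also have "\<dots> = v x [^] (n + 1) \<otimes> finprod G v (P - {x})"
    using vx rest card by (subst finprod_multf) (auto simp: finprod_const prodP)
  \<comment> \<open>One of the \<open>n + 1\<close> factors \<open>v x\<close> completes the product
    over \<open>P - {x}\<close> to the product over \<open>P\<close>.\<close>
  also have "\<dots> = v x [^] n \<otimes> finprod G v P"
  proof -
    have "finprod G v (P - {x}) \<in> carrier G" using v by (intro finprod_closed) auto
    then show ?thesis using vx split[OF fin x] by (simp add: m_assoc)
  qed
  finally show ?thesis by simp
qed

theorem theorem8:
  fixes P :: "'a set" and L :: "'a set set" and n :: nat
    and G :: "('g, 'r) monoid_scheme"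
  assumes "projective_plane P L"
    and "finite P"
    and "has_order L n"
    and "Factorial_Ring.prime n"
    and "comm_group G"
    and "magic_over P L G"
  shows "\<exists>H. subgroup H G \<and>
    product_group {..<3::nat} (\<lambda>_. integer_mod_group n) \<cong> G\<lparr>carrier := H\<rparr>"
proof -
  interpret projective_plane P L by fact
  interpret comm_group G by fact
  let ?Z = "product_group {..<3::nat} (\<lambda>_. integer_mod_group n)"
  obtain v c where v: "v \<in> P \<rightarrow> carrier G" and inj: "inj_on v P"
    and sums: "\<And>l. l \<in> L \<Longrightarrow> finprod G v l = c"
    using assms(6) unfolding magic_over_def magic_function_def by blast
  obtain x0 where x0: "x0 \<in> P" using ex_quadrangle by fastforce
  have vc: "v x \<in> carrier G" if "x \<in> P" for x using v that by blast
  have const: "v x [^]\<^bsub>G\<^esub> n \<otimes>\<^bsub>G\<^esub> finprod G v P = c [^]\<^bsub>G\<^esub> (n + 1)" if "x \<in> P" for x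
    using magic_power_constant[OF assms(1-3,5) v _ that] sums by blast
  have pow: "v x [^]\<^bsub>G\<^esub> n = v x0 [^]\<^bsub>G\<^esub> n" if "x \<in> P" for x
    using const[OF that] const[OF x0] vc[OF that] vc[OF x0] finprod_closed[OF v]
    by (metis nat_pow_closed r_cancel)
  \<comment> \<open>Dividing by \<open>v x0\<close> keeps the values distinct and moves them into
    the \<open>n\<close>-torsion.\<close>
  let ?w = "\<lambda>x. v x \<otimes>\<^bsub>G\<^esub> inv\<^bsub>G\<^esub> v x0"
  have "inj_on ?w P"
    using inj vc x0 by (auto simp: inj_on_def)
  then have "card (?w ` P) = n\<^sup>2 + n + 1"
    using order_counts(3)[OF assms(2,3)] by (simp only: card_image)
  then have "n ^ (3 - 1) < card (?w ` P)" by simp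
  moreover have "?w ` P \<subseteq> {y \<in> carrier G. y [^]\<^bsub>G\<^esub> n = \<one>\<^bsub>G\<^esub>}"
  proof (rule image_subsetI)
    fix x assume x: "x \<in> P"
    have "?w x [^]\<^bsub>G\<^esub> n = v x [^]\<^bsub>G\<^esub> n \<otimes>\<^bsub>G\<^esub> inv\<^bsub>G\<^esub> (v x0 [^]\<^bsub>G\<^esub> n)"
      using vc[OF x] vc[OF x0] by (simp add: nat_pow_distrib nat_pow_inv)
    also have "\<dots> = \<one>\<^bsub>G\<^esub>" unfolding pow[OF x] using vc[OF x0] by simp
    finally show "?w x \<in> {y \<in> carrier G. y [^]\<^bsub>G\<^esub> n = \<one>\<^bsub>G\<^esub>}"
      using vc[OF x] vc[OF x0] by simp
  qed
  ultimately obtain h where h: "h \<in> hom ?Z G" and hinj: "inj_on h (carrier ?Z)"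
    using elementary_abelian_embedding[OF assms(4)] by blast
  interpret h: group_hom ?Z G h
    using h by (simp add: group_hom_def group_hom_axioms_def)
  \<comment> \<open>The subgroup sought is the image of \<open>h\<close>; restricting the codomain
    to it makes \<open>h\<close> bijective.\<close>
  have "h \<in> iso ?Z (G\<lparr>carrier := h ` carrier ?Z\<rparr>)"
    using h hinj by (auto simp: iso_def hom_def bij_betw_def)
  then show ?thesis using h.img_is_subgroup is_isoI by blast
qed

end
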